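(* Let $R$ be a ring and let $M=\bigoplus_{i=1}^nM_i$ be a direct sum of Euclidean $R$-modules $M_i$. Then every nonzero matrix $A\in M_{m,n}(M_1,\ldots,M_n)$ is left-row equivalent to a matrix in left reduced echelon form.
   Context: Rings are unital and modules are left modules. A poset is Artinian if every descending chain in it stabilizes. An $R$-module $E$ is a Euclidean module if there is a function $d_E:E\setminus\{0\}\to P$ to a poset $(P,\ge)$ (the degree) such that the poset $\mathrm{im}(d_E)$ is Artinian and, for any nonzero $u,v\in E$, there are $q\in R$ and $r\in E$ with $u=qv+r$ and either $r=0$ or $d_E(r)<d_E(v)$. $M_{m,n}(M_1,\ldots,M_n)$ is the set of $m\times n$ matrices $(a_{ij})$ with $a_{ij}\in M_j$, with rows $a_1,\ldots,a_m$. Elementary row operations: (ER1) $a_i\mapsto a_i+\sum_{j\neq i}r_ja_j$ with $r_j\in R$; (ER2) swapping two rows. Two $m\times n$ matrices are left-row equivalent if one is obtained from the other by finitely many operations (ER1), (ER2). A matrix is in (left) reduced echelon form if: (1) every nonzero row has a leftmost nonzero entry, called its pivot; (2) if the pivot of row $i$ is in column $j$, then all entries of column $j$ below the pivot are zero, and each entry of column $j$ above the pivot is zero or has degree (in $M_j$) strictly less than the degree of the pivot; (3) the pivot of each nonzero row lies strictly to the right of the pivot of the row above it (in particular zero rows are at the bottom). *)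

theory Defs
  imports "HOL-Algebra.Module" "HOL-Library.FuncSet"
begin

text \<open>The library locale \<^locale>\<open>module\<close> requires a commutative ring of scalars;
  here the ring is an arbitrary unital one. The record type of the library is reused.
  Its multiplicative fields play no role.\<close>

locale left_module = R?: ring R + M?: abelian_group M for R (structure) and M (structure) +
  assumes smult_closed [simp, intro]:
      "\<lbrakk>a \<in> carrier R; x \<in> carrier M\<rbrakk> \<Longrightarrow> a \<odot>\<^bsub>M\<^esub> x \<in> carrier M"
    and smult_l_distr:
      "\<lbrakk>a \<in> carrier R; b \<in> carrier R; x \<in> carrier M\<rbrakk> \<Longrightarrow>
        (a \<oplus>\<^bsub>R\<^esub> b) \<odot>\<^bsub>M\<^esub> x = a \<odot>\<^bsub>M\<^esub> x \<oplus>\<^bsub>M\<^esub> b \<odot>\<^bsub>M\<^esub> x"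
    and smult_r_distr:
      "\<lbrakk>a \<in> carrier R; x \<in> carrier M; y \<in> carrier M\<rbrakk> \<Longrightarrow>
        a \<odot>\<^bsub>M\<^esub> (x \<oplus>\<^bsub>M\<^esub> y) = a \<odot>\<^bsub>M\<^esub> x \<oplus>\<^bsub>M\<^esub> a \<odot>\<^bsub>M\<^esub> y"
    and smult_assoc1:
      "\<lbrakk>a \<in> carrier R; b \<in> carrier R; x \<in> carrier M\<rbrakk> \<Longrightarrow>
        (a \<otimes>\<^bsub>R\<^esub> b) \<odot>\<^bsub>M\<^esub> x = a \<odot>\<^bsub>M\<^esub> (b \<odot>\<^bsub>M\<^esub> x)"
    and smult_one [simp]:
      "x \<in> carrier M \<Longrightarrow> \<one>\<^bsub>R\<^esub> \<odot>\<^bsub>M\<^esub> x = x"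

text \<open>A pair \<open>(p, q)\<close> in the relation \<open>leq\<close> means \<open>p \<le> q\<close>.\<close>

definition artinian_poset :: "'p set \<Rightarrow> 'p rel \<Rightarrow> bool" where
  "artinian_poset S leq \<longleftrightarrow>
    (\<forall>f :: nat \<Rightarrow> 'p. (\<forall>k. f k \<in> S) \<and> (\<forall>k. (f (Suc k), f k) \<in> leq) \<longrightarrow>
      (\<exists>N. \<forall>k\<ge>N. f k = f N))"

text \<open>The echelon form depends on the choice of the degree function, so the poset
  \<open>(P, leq)\<close> and the degree \<open>d\<close> witnessing that the module \<open>E\<close> is Euclidean are locale
  parameters. The value of \<open>d\<close> at \<open>\<zero>\<^bsub>E\<^esub>\<close> and outside the carrier is unspecified.\<close>

locale euclidean_module = left_module R E
  for R (structure) and E (structure) and P :: "'p set" and leq :: "'p rel" and d +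
  assumes poset: "partial_order_on P leq"
    and degree_closed: "d \<in> carrier E - {\<zero>\<^bsub>E\<^esub>} \<rightarrow> P"
    and artinian: "artinian_poset (d ` (carrier E - {\<zero>\<^bsub>E\<^esub>})) leq"
    and division:
      "\<lbrakk>u \<in> carrier E - {\<zero>\<^bsub>E\<^esub>}; v \<in> carrier E - {\<zero>\<^bsub>E\<^esub>}\<rbrakk> \<Longrightarrow>
        \<exists>q \<in> carrier R. \<exists>r \<in> carrier E. u = q \<odot>\<^bsub>E\<^esub> v \<oplus>\<^bsub>E\<^esub> r \<and>
          (r = \<zero>\<^bsub>E\<^esub> \<or> ((d r, d v) \<in> leq \<and> d r \<noteq> d v))"

text \<open>The direct sum of the finite family \<open>M 1, \<dots>, M n\<close>; no support condition is needed.\<close>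

definition direct_sum :: "nat \<Rightarrow> (nat \<Rightarrow> ('a, 'b, 'm) module_scheme) \<Rightarrow> ('a, nat \<Rightarrow> 'b) module" where
  "direct_sum n M =
    \<lparr>carrier = (\<Pi>\<^sub>E j\<in>{1..n}. carrier (M j)), mult = undefined, one = undefined,
     zero = (\<lambda>j\<in>{1..n}. \<zero>\<^bsub>M j\<^esub>),
     add = (\<lambda>x y. \<lambda>j\<in>{1..n}. x j \<oplus>\<^bsub>M j\<^esub> y j),
     smult = (\<lambda>r x. \<lambda>j\<in>{1..n}. r \<odot>\<^bsub>M j\<^esub> x j)\<rparr>"

text \<open>An \<open>m \<times> n\<close> matrix whose \<open>j\<close>-th column has entries in \<open>M j\<close> is the family of its
  rows \<open>A 1, \<dots>, A m\<close>, each an element of the direct sum; its entries are \<open>A i j\<close>.\<close>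

definition matrices ::
  "nat \<Rightarrow> nat \<Rightarrow> (nat \<Rightarrow> ('a, 'b, 'm) module_scheme) \<Rightarrow> (nat \<Rightarrow> nat \<Rightarrow> 'b) set" where
  "matrices m n M = {1..m} \<rightarrow>\<^sub>E carrier (direct_sum n M)"

definition zero_matrix ::
  "nat \<Rightarrow> nat \<Rightarrow> (nat \<Rightarrow> ('a, 'b, 'm) module_scheme) \<Rightarrow> nat \<Rightarrow> nat \<Rightarrow> 'b" where
  "zero_matrix m n M = (\<lambda>i\<in>{1..m}. \<zero>\<^bsub>direct_sum n M\<^esub>)"

inductive row_op ::
  "('a, 'r) ring_scheme \<Rightarrow> nat \<Rightarrow> nat \<Rightarrow> (nat \<Rightarrow> ('a, 'b, 'm) module_scheme) \<Rightarrow>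
    (nat \<Rightarrow> nat \<Rightarrow> 'b) \<Rightarrow> (nat \<Rightarrow> nat \<Rightarrow> 'b) \<Rightarrow> bool"
  for R and m n :: nat and M where
  ER1: "\<lbrakk>i \<in> {1..m}; r \<in> {1..m} - {i} \<rightarrow> carrier R\<rbrakk> \<Longrightarrow>
      row_op R m n M A
        (A(i := A i \<oplus>\<^bsub>direct_sum n M\<^esub>
          (\<Oplus>\<^bsub>direct_sum n M\<^esub> k\<in>{1..m} - {i}. r k \<odot>\<^bsub>direct_sum n M\<^esub> A k)))"
| ER2: "\<lbrakk>i \<in> {1..m}; k \<in> {1..m}; i \<noteq> k\<rbrakk> \<Longrightarrow>
      row_op R m n M A (A(i := A k, k := A i))"

text \<open>Every row operation is undone by a row operation, so this is a symmetric relation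
  on matrices (proved below).\<close>

definition left_row_equivalent ::
  "('a, 'r) ring_scheme \<Rightarrow> nat \<Rightarrow> nat \<Rightarrow> (nat \<Rightarrow> ('a, 'b, 'm) module_scheme) \<Rightarrow>
    (nat \<Rightarrow> nat \<Rightarrow> 'b) \<Rightarrow> (nat \<Rightarrow> nat \<Rightarrow> 'b) \<Rightarrow> bool" where
  "left_row_equivalent R m n M A B \<longleftrightarrow> (row_op R m n M)\<^sup>*\<^sup>* A B"

definition is_pivot ::
  "nat \<Rightarrow> nat \<Rightarrow> (nat \<Rightarrow> ('a, 'b, 'm) module_scheme) \<Rightarrow> (nat \<Rightarrow> nat \<Rightarrow> 'b) \<Rightarrow> nat \<Rightarrow> nat \<Rightarrow> bool" where
  "is_pivot m n M A i j \<longleftrightarrow> i \<in> {1..m} \<and> j \<in> {1..n} \<and> A i j \<noteq> \<zero>\<^bsub>M j\<^esub> \<and>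
    (\<forall>k\<in>{1..<j}. A i k = \<zero>\<^bsub>M k\<^esub>)"

text \<open>The first conjunct holds for every matrix. In the last one, the existence of a pivot
  in row \<open>i - 1\<close> forces the zero rows to be at the bottom.\<close>

definition reduced_echelon_form ::
  "nat \<Rightarrow> nat \<Rightarrow> (nat \<Rightarrow> ('a, 'b, 'm) module_scheme) \<Rightarrow> (nat \<Rightarrow> 'p rel) \<Rightarrow> (nat \<Rightarrow> 'b \<Rightarrow> 'p) \<Rightarrow>
    (nat \<Rightarrow> nat \<Rightarrow> 'b) \<Rightarrow> bool" where
  "reduced_echelon_form m n M leq d A \<longleftrightarrow>
    (\<forall>i\<in>{1..m}. A i \<noteq> \<zero>\<^bsub>direct_sum n M\<^esub> \<longrightarrow> (\<exists>j. is_pivot m n M A i j)) \<and>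
    (\<forall>i j. is_pivot m n M A i j \<longrightarrow>
      (\<forall>k\<in>{i<..m}. A k j = \<zero>\<^bsub>M j\<^esub>) \<and>
      (\<forall>k\<in>{1..<i}. A k j = \<zero>\<^bsub>M j\<^esub> \<or>
        ((d j (A k j), d j (A i j)) \<in> leq j \<and> d j (A k j) \<noteq> d j (A i j)))) \<and>
    (\<forall>i j. is_pivot m n M A i j \<and> 1 < i \<longrightarrow> (\<exists>j'<j. is_pivot m n M A (i - 1) j'))"

lemma left_module_direct_sum:
  assumes R: "ring R" and M: "\<And>j. j \<in> {1..n} \<Longrightarrow> left_module R (M j)"
  shows "left_module R (direct_sum n M)"
proof -
  have ag: "abelian_group (M j)" if "j \<in> {1..n}" for j
    using M[OF that] by (simp add: left_module_def)
  note am = abelian_group.axioms(1)[OF ag]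
  have "abelian_group (direct_sum n M)"
  proof (rule abelian_groupI)
    fix x assume x: "x \<in> carrier (direct_sum n M)"
    show "\<exists>y\<in>carrier (direct_sum n M). y \<oplus>\<^bsub>direct_sum n M\<^esub> x = \<zero>\<^bsub>direct_sum n M\<^esub>"
      by (rule bexI[of _ "\<lambda>j\<in>{1..n}. \<ominus>\<^bsub>M j\<^esub> x j"])
        (use x in \<open>auto simp: direct_sum_def PiE_def Pi_def fun_eq_iff restrict_def extensional_def
          abelian_group.l_neg[OF ag] abelian_group.a_inv_closed[OF ag]\<close>)
  qed (auto simp: direct_sum_def PiE_def Pi_def fun_eq_iff restrict_def extensional_def
      intro!: abelian_monoid.a_assoc[OF am] abelian_monoid.a_comm[OF am]
        abelian_monoid.l_zero[OF am] abelian_monoid.zero_closed[OF am]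
        abelian_monoid.a_closed[OF am])
  moreover have "left_module_axioms R (direct_sum n M)"
    by unfold_locales
      (auto simp: direct_sum_def PiE_def Pi_def fun_eq_iff restrict_def extensional_def
        left_module.smult_l_distr[OF M] left_module.smult_r_distr[OF M]
        left_module.smult_assoc1[OF M] left_module.smult_one[OF M]
        left_module.smult_closed[OF M])
  ultimately show ?thesis
    using R by (simp add: left_module_def)
qed

lemma row_op_reverse:
  assumes R: "ring R" and M: "\<And>j. j \<in> {1..n} \<Longrightarrow> left_module R (M j)"
    and op: "row_op R m n M A B" and A: "A \<in> matrices m n M"
  shows "B \<in> matrices m n M \<and> row_op R m n M B A"
proof -
  let ?D = "direct_sum n M"
  interpret D: left_module R ?D
    by (rule left_module_direct_sum[OF R M])
  have Ac: "A k \<in> carrier ?D" if "k \<in> {1..m}" for k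
    using A that by (auto simp: matrices_def)
  from op show ?thesis
  proof cases
    case (ER1 i r)
    let ?K = "{1..m} - {i}"
    let ?s = "\<Oplus>\<^bsub>?D\<^esub>k\<in>?K. r k \<odot>\<^bsub>?D\<^esub> A k"
    let ?t = "\<Oplus>\<^bsub>?D\<^esub>k\<in>?K. (\<ominus>\<^bsub>R\<^esub> r k) \<odot>\<^bsub>?D\<^esub> B k"
    have cl: "r k \<odot>\<^bsub>?D\<^esub> A k \<in> carrier ?D" "(\<ominus>\<^bsub>R\<^esub> r k) \<odot>\<^bsub>?D\<^esub> A k \<in> carrier ?D"
      if "k \<in> ?K" for k
      using that ER1 Ac by (auto simp: Pi_def)
    have s: "?s \<in> carrier ?D"
      using cl by (intro D.M.finsum_closed) auto
    have B: "B \<in> matrices m n M"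
      using A s ER1 Ac by (auto simp: matrices_def PiE_def extensional_def Pi_def)
    have t: "?t = (\<Oplus>\<^bsub>?D\<^esub>k\<in>?K. (\<ominus>\<^bsub>R\<^esub> r k) \<odot>\<^bsub>?D\<^esub> A k)"
      using cl ER1 by (intro D.M.finsum_cong') auto
    have zero: "\<zero>\<^bsub>R\<^esub> \<odot>\<^bsub>?D\<^esub> x = \<zero>\<^bsub>?D\<^esub>" if x: "x \<in> carrier ?D" for x
      using D.smult_l_distr[of "\<zero>\<^bsub>R\<^esub>" "\<zero>\<^bsub>R\<^esub>" x] x
      by (metis D.M.add.l_cancel_one D.R.l_zero D.R.zero_closed D.smult_closed)
    have st: "?s \<oplus>\<^bsub>?D\<^esub> ?t = \<zero>\<^bsub>?D\<^esub>"
    proof -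
      have "?s \<oplus>\<^bsub>?D\<^esub> ?t =
          (\<Oplus>\<^bsub>?D\<^esub>k\<in>?K. r k \<odot>\<^bsub>?D\<^esub> A k \<oplus>\<^bsub>?D\<^esub> (\<ominus>\<^bsub>R\<^esub> r k) \<odot>\<^bsub>?D\<^esub> A k)"
        unfolding t using cl by (intro D.M.finsum_addf[symmetric]) auto
      also have "\<dots> = (\<Oplus>\<^bsub>?D\<^esub>k\<in>?K. \<zero>\<^bsub>?D\<^esub>)"
      proof (intro D.M.finsum_cong')
        fix k assume k: "k \<in> ?K"
        then have "r k \<in> carrier R" "A k \<in> carrier ?D"
          using ER1 Ac by auto
        then show "r k \<odot>\<^bsub>?D\<^esub> A k \<oplus>\<^bsub>?D\<^esub> (\<ominus>\<^bsub>R\<^esub> r k) \<odot>\<^bsub>?D\<^esub> A k = \<zero>\<^bsub>?D\<^esub>"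
          by (simp add: D.smult_l_distr[symmetric] D.R.r_neg zero)
      qed auto
      finally show ?thesis
        by simp
    qed
    have t_closed: "?t \<in> carrier ?D"
      unfolding t using cl by (intro D.M.finsum_closed) auto
    have "B i \<oplus>\<^bsub>?D\<^esub> ?t = A i"
      using ER1 Ac[of i] s t_closed st by (simp add: D.M.a_assoc)
    then have "A = B(i := B i \<oplus>\<^bsub>?D\<^esub> ?t)"
      by (simp add: ER1(1))
    moreover have "row_op R m n M B (B(i := B i \<oplus>\<^bsub>?D\<^esub> ?t))"
      using ER1 by (intro row_op.ER1) auto
    ultimately show ?thesis
      using B by simp
  next
    case (ER2 i k)
    have "A = B(i := B k, k := B i)"
      using ER2 by (auto simp: fun_eq_iff)
    moreover have "row_op R m n M B (B(i := B k, k := B i))"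
      using ER2 by (intro row_op.ER2) auto
    moreover have "B \<in> matrices m n M"
      using A ER2 by (auto simp: matrices_def PiE_def extensional_def Pi_def)
    ultimately show ?thesis
      by simp
  qed
qed

lemma left_row_equivalent_sym:
  assumes R: "ring R" and M: "\<And>j. j \<in> {1..n} \<Longrightarrow> left_module R (M j)"
    and AB: "left_row_equivalent R m n M A B" and A: "A \<in> matrices m n M"
  shows "left_row_equivalent R m n M B A"
proof -
  have "B \<in> matrices m n M \<and> (row_op R m n M)\<^sup>*\<^sup>* B A"
    using AB unfolding left_row_equivalent_def
  proof (induction rule: rtranclp_induct)
    case base
    then show ?case using A by simp
  next
    case (step y z)
    then have "z \<in> matrices m n M \<and> row_op R m n M z y"
      by (intro row_op_reverse[OF R M]) auto
    with step show ?case
      by (auto intro: converse_rtranclp_into_rtranclp)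
  qed
  then show ?thesis
    by (simp add: left_row_equivalent_def)
qed

end

theory Submission
  imports Defs
begin

text \<open>Columns are treated from left to right. In a column, the rows without a pivot so far are
  divided by one that has a nonzero entry there. As long as some remainder is nonzero, it has
  smaller degree and takes the role of the divisor. The Artinian condition ends this Euclidean
  algorithm with a single nonzero entry, the new pivot, by which the entries above are then divided.
  The pivot row vanishes in all earlier columns, so these are not disturbed.\<close>

section \<open>Module arithmetic, induction on the degree, and division with remainder\<close>

context left_module
begin

lemma smult_l_null:
  assumes "x \<in> carrier M"
  shows "\<zero> \<odot>\<^bsub>M\<^esub> x = \<zero>\<^bsub>M\<^esub>"
  using smult_l_distr[of "\<zero>" "\<zero>" x] assms
  by (metis M.add.l_cancel_one R.l_zero R.zero_closed smult_closed)

lemma smult_r_null: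
  assumes "a \<in> carrier R"
  shows "a \<odot>\<^bsub>M\<^esub> \<zero>\<^bsub>M\<^esub> = \<zero>\<^bsub>M\<^esub>"
  using smult_r_distr[of a "\<zero>\<^bsub>M\<^esub>" "\<zero>\<^bsub>M\<^esub>"] assms
  by (metis M.add.l_cancel_one M.l_zero M.zero_closed smult_closed)

lemma smult_l_neg:
  assumes "a \<in> carrier R" "x \<in> carrier M"
  shows "(\<ominus> a) \<odot>\<^bsub>M\<^esub> x \<oplus>\<^bsub>M\<^esub> a \<odot>\<^bsub>M\<^esub> x = \<zero>\<^bsub>M\<^esub>"
  using assms by (simp add: smult_l_distr[symmetric] R.l_neg smult_l_null)

end

context euclidean_module
begin

definition degree_less :: "'c \<Rightarrow> 'c \<Rightarrow> bool" where
  "degree_less x y \<longleftrightarrow> (d x, d y) \<in> leq \<and> d x \<noteq> d y"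

text \<open>An infinite chain of elements with strictly decreasing degrees would give a descending
  sequence of degrees that never stabilizes, against the Artinian condition. So the relation on
  nonzero elements is well-founded, and one can induct on the elements themselves instead of on
  their degrees.\<close>

lemma degree_less_induct [consumes 1, case_names less]:
  assumes "x \<in> carrier E - {\<zero>\<^bsub>E\<^esub>}"
    and "\<And>x. \<lbrakk>x \<in> carrier E - {\<zero>\<^bsub>E\<^esub>};
      \<And>y. \<lbrakk>y \<in> carrier E - {\<zero>\<^bsub>E\<^esub>}; degree_less y x\<rbrakk> \<Longrightarrow> Q y\<rbrakk> \<Longrightarrow> Q x"
  shows "Q x"
proof -
  let ?C = "carrier E - {\<zero>\<^bsub>E\<^esub>}"
  let ?r = "{(x, y). x \<in> ?C \<and> y \<in> ?C \<and> degree_less x y}"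
  have "wf ?r"
    unfolding wf_iff_no_infinite_down_chain
  proof
    assume "\<exists>f. \<forall>i. (f (Suc i), f i) \<in> ?r"
    then obtain f where f: "\<And>i. (f (Suc i), f i) \<in> ?r"
      by blast
    then have "\<forall>k. d (f k) \<in> d ` ?C" "\<forall>k. (d (f (Suc k)), d (f k)) \<in> leq"
      by (auto simp: degree_less_def)
    with artinian obtain N where "\<forall>k\<ge>N. d (f k) = d (f N)"
      unfolding artinian_poset_def by (auto dest: spec[of _ "\<lambda>k. d (f k)"])
    then have "d (f (Suc N)) = d (f N)"
      using le_SucI by blast
    with f[of N] show False
      by (simp add: degree_less_def)
  qed
  then show ?thesis
    using assms(1)
  proof (induction x rule: wf_induct_rule)
    case (less x)
    show ?case
      by (rule assms(2)) (use less in auto)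
  qed
qed

text \<open>Division in the form needed for row operations, where a multiple of \<open>v\<close> is
  added to \<open>u\<close>: the coefficient is the negative of the quotient. The case
  \<open>u = 0\<close>, on which \<open>division\<close> is silent, is included with coefficient
  zero, so zero entries of a column need no separate treatment.\<close>

lemma remainder:
  assumes "u \<in> carrier E" "v \<in> carrier E - {\<zero>\<^bsub>E\<^esub>}"
  obtains q where "q \<in> carrier R"
    "u \<oplus>\<^bsub>E\<^esub> q \<odot>\<^bsub>E\<^esub> v = \<zero>\<^bsub>E\<^esub> \<or> degree_less (u \<oplus>\<^bsub>E\<^esub> q \<odot>\<^bsub>E\<^esub> v) v"
proof (cases "u = \<zero>\<^bsub>E\<^esub>")
  case True
  with assms that[of "\<zero>"] show ?thesis
    by (simp add: smult_l_null)
next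
  case False
  with assms obtain q r where q: "q \<in> carrier R" and r: "r \<in> carrier E"
    and u: "u = q \<odot>\<^bsub>E\<^esub> v \<oplus>\<^bsub>E\<^esub> r" and less: "r = \<zero>\<^bsub>E\<^esub> \<or> degree_less r v"
    using division[of u v] by (auto simp: degree_less_def)
  have "u \<oplus>\<^bsub>E\<^esub> (\<ominus> q) \<odot>\<^bsub>E\<^esub> v = r \<oplus>\<^bsub>E\<^esub> ((\<ominus> q) \<odot>\<^bsub>E\<^esub> v \<oplus>\<^bsub>E\<^esub> q \<odot>\<^bsub>E\<^esub> v)"
    using assms q r unfolding u by (simp add: M.a_ac)
  also have "\<dots> = r"
    using assms q r by (simp add: smult_l_neg)
  finally show ?thesis
    using less q that[of "\<ominus> q"] by simp
qed

end

section \<open>Matrices over a family of Euclidean modules, and composite row operations\<close>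

locale euclidean_modules = R?: ring R for R (structure) +
  fixes M :: "nat \<Rightarrow> ('a, 'b, 'm) module_scheme"
    and P :: "nat \<Rightarrow> 'p set"
    and leq :: "nat \<Rightarrow> 'p rel"
    and d :: "nat \<Rightarrow> 'b \<Rightarrow> 'p"
    and m n :: nat
  assumes euclidean: "j \<in> {1..n} \<Longrightarrow> euclidean_module R (M j) (P j) (leq j) (d j)"
begin

abbreviation deg_less :: "nat \<Rightarrow> 'b \<Rightarrow> 'b \<Rightarrow> bool" where
  "deg_less j \<equiv> euclidean_module.degree_less (leq j) (d j)"

lemma deg_less_iff:
  "j \<in> {1..n} \<Longrightarrow> deg_less j x y \<longleftrightarrow> (d j x, d j y) \<in> leq j \<and> d j x \<noteq> d j y"
  by (rule euclidean_module.degree_less_def[OF euclidean])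

lemma left_module: "j \<in> {1..n} \<Longrightarrow> left_module R (M j)"
  using euclidean by (simp add: euclidean_module_def)

sublocale D: left_module R "direct_sum n M"
  by (rule left_module_direct_sum[OF R.ring_axioms left_module])

lemma row_closed: "A \<in> matrices m n M \<Longrightarrow> i \<in> {1..m} \<Longrightarrow> A i \<in> carrier (direct_sum n M)"
  by (auto simp: matrices_def)

lemma entry_closed:
  "A \<in> matrices m n M \<Longrightarrow> i \<in> {1..m} \<Longrightarrow> j \<in> {1..n} \<Longrightarrow> A i j \<in> carrier (M j)"
  by (drule (1) row_closed) (auto simp: direct_sum_def PiE_def Pi_def)

lemma row_op_add_row:
  assumes A: "A \<in> matrices m n M" and ik: "i \<in> {1..m}" "k \<in> {1..m}" "i \<noteq> k"
    and q: "q \<in> carrier R"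
  shows "row_op R m n M A
    (A(k := A k \<oplus>\<^bsub>direct_sum n M\<^esub> q \<odot>\<^bsub>direct_sum n M\<^esub> A i))"
proof -
  let ?D = "direct_sum n M"
  \<comment> \<open>A coefficient family supported at \<open>i\<close> alone collapses the sum in
    \<open>ER1\<close> to a single term.\<close>
  define r where "r = (\<lambda>l. if l = i then q else \<zero>)"
  have "(\<Oplus>\<^bsub>?D\<^esub>l\<in>{1..m} - {k}. r l \<odot>\<^bsub>?D\<^esub> A l) =
      (\<Oplus>\<^bsub>?D\<^esub>l\<in>{1..m} - {k}. if i = l then q \<odot>\<^bsub>?D\<^esub> A l else \<zero>\<^bsub>?D\<^esub>)"
    using A q by (intro D.M.finsum_cong') (auto simp: r_def D.smult_l_null row_closed)
  also have "\<dots> = q \<odot>\<^bsub>?D\<^esub> A i"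
    using A ik q by (intro D.M.finsum_singleton) (auto simp: row_closed)
  finally show ?thesis
    using row_op.ER1[of k m r R n M A] ik q by (simp add: r_def)
qed

lemma row_op_matrices:
  "row_op R m n M A B \<Longrightarrow> A \<in> matrices m n M \<Longrightarrow> B \<in> matrices m n M"
  using row_op_reverse[where M = M, OF R.ring_axioms left_module] by blast

lemma row_equivalent_matrices:
  "left_row_equivalent R m n M A B \<Longrightarrow> A \<in> matrices m n M \<Longrightarrow> B \<in> matrices m n M"
  unfolding left_row_equivalent_def
  by (induction rule: rtranclp_induct) (auto intro: row_op_matrices)

lemma row_equivalent_trans:
  "\<lbrakk>left_row_equivalent R m n M A B; left_row_equivalent R m n M B C\<rbrakk>
    \<Longrightarrow> left_row_equivalent R m n M A C"
  by (simp add: left_row_equivalent_def)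

text \<open>The rows of \<open>K\<close> can be changed one after another: row \<open>i\<close> lies
  outside \<open>K\<close> and so stays the same throughout, and each change leaves the other rows
  alone. The result is therefore described by the original rows of \<open>A\<close> only.\<close>

lemma row_equivalent_add_rows:
  assumes A: "A \<in> matrices m n M" and i: "i \<in> {1..m}"
    and K: "K \<subseteq> {1..m} - {i}" and q: "q \<in> K \<rightarrow> carrier R"
  shows "left_row_equivalent R m n M A
    (\<lambda>k. if k \<in> K then A k \<oplus>\<^bsub>direct_sum n M\<^esub> q k \<odot>\<^bsub>direct_sum n M\<^esub> A i else A k)"
proof -
  from K have "finite K"
    by (rule finite_subset) simp
  then show ?thesis
    using K q
  proof (induction K rule: finite_induct)
    case empty
    then show ?case
      by (simp add: left_row_equivalent_def)
  next
    case (insert x K)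
    let ?D = "direct_sum n M"
    let ?B = "\<lambda>K k. if k \<in> K then A k \<oplus>\<^bsub>?D\<^esub> q k \<odot>\<^bsub>?D\<^esub> A i else A k"
    have eq: "left_row_equivalent R m n M A (?B K)"
      using insert by auto
    have "row_op R m n M (?B K) ((?B K)(x := ?B K x \<oplus>\<^bsub>?D\<^esub> q x \<odot>\<^bsub>?D\<^esub> ?B K i))"
      using insert row_equivalent_matrices[OF eq A] i by (intro row_op_add_row) auto
    also have "(?B K)(x := ?B K x \<oplus>\<^bsub>?D\<^esub> q x \<odot>\<^bsub>?D\<^esub> ?B K i) = ?B (insert x K)"
      using insert by (auto simp: fun_eq_iff)
    finally show ?case
      using eq by (simp add: left_row_equivalent_def)
  qed
qed

text \<open>One round of division by row \<open>i\<close> in column \<open>j\<close>. It serves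
  twice: on the rows below a divisor in the Euclidean algorithm, and on the rows above a finished
  pivot. The third conclusion protects the columns where the divisor row vanishes, since multiples
  of zero are added there.\<close>

lemma divide_rows:
  assumes A: "A \<in> matrices m n M" and i: "i \<in> {1..m}" and j: "j \<in> {1..n}"
    and nz: "A i j \<noteq> \<zero>\<^bsub>M j\<^esub>" and K: "K \<subseteq> {1..m} - {i}"
  obtains B where "left_row_equivalent R m n M A B" "\<And>k. k \<notin> K \<Longrightarrow> B k = A k"
    "\<And>k l. \<lbrakk>k \<in> K; l \<in> {1..n}; A i l = \<zero>\<^bsub>M l\<^esub>\<rbrakk> \<Longrightarrow> B k l = A k l"
    "\<And>k. k \<in> K \<Longrightarrow> B k j = \<zero>\<^bsub>M j\<^esub> \<or> deg_less j (B k j) (A i j)"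
proof -
  let ?D = "direct_sum n M"
  interpret E: euclidean_module R "M j" "P j" "leq j" "d j"
    by (rule euclidean[OF j])
  have "\<exists>q. q \<in> carrier R \<and> (A k j \<oplus>\<^bsub>M j\<^esub> q \<odot>\<^bsub>M j\<^esub> A i j = \<zero>\<^bsub>M j\<^esub> \<or>
      deg_less j (A k j \<oplus>\<^bsub>M j\<^esub> q \<odot>\<^bsub>M j\<^esub> A i j) (A i j))" if "k \<in> K" for k
  proof -
    have "A k j \<in> carrier (M j)" "A i j \<in> carrier (M j) - {\<zero>\<^bsub>M j\<^esub>}"
      using A i j nz K that by (auto simp: entry_closed)
    then show ?thesis
      by (metis E.remainder)
  qed
  then obtain q where q: "\<And>k. k \<in> K \<Longrightarrow> q k \<in> carrier R"
    and rem: "\<And>k. k \<in> K \<Longrightarrow> A k j \<oplus>\<^bsub>M j\<^esub> q k \<odot>\<^bsub>M j\<^esub> A i j = \<zero>\<^bsub>M j\<^esub> \<or>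
      deg_less j (A k j \<oplus>\<^bsub>M j\<^esub> q k \<odot>\<^bsub>M j\<^esub> A i j) (A i j)"
    by metis
  define B where "B = (\<lambda>k. if k \<in> K then A k \<oplus>\<^bsub>?D\<^esub> q k \<odot>\<^bsub>?D\<^esub> A i else A k)"
  have B: "B k l = A k l \<oplus>\<^bsub>M l\<^esub> q k \<odot>\<^bsub>M l\<^esub> A i l" if "k \<in> K" "l \<in> {1..n}" for k l
    using that by (simp add: B_def direct_sum_def)
  show ?thesis
  proof (rule that[of B])
    show "left_row_equivalent R m n M A B"
      unfolding B_def using A i K q by (intro row_equivalent_add_rows) auto
    show "B k l = A k l" if "k \<in> K" "l \<in> {1..n}" "A i l = \<zero>\<^bsub>M l\<^esub>" for k l
    proof -
      interpret L: left_module R "M l"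
        by (rule left_module[OF that(2)])
      have "A k l \<in> carrier (M l)"
        using A K that by (auto simp: entry_closed)
      then show ?thesis
        using that q by (simp add: B L.smult_r_null)
    qed
  qed (use B rem j in \<open>auto simp: B_def\<close>)
qed

section \<open>The Euclidean algorithm in one column\<close>

lemma row_equivalent_swap:
  assumes "i \<in> {1..m}" "k \<in> {1..m}"
  shows "left_row_equivalent R m n M A (A(i := A k, k := A i))"
  using row_op.ER2[of i m k R n M A] assms
  \<comment> \<open>\<open>ER2\<close> demands distinct rows; for \<open>i = k\<close> the update
    changes nothing and the empty chain of operations suffices.\<close>
  by (cases "i = k") (auto simp: left_row_equivalent_def)

text \<open>Induction on the degree of the entry \<open>A i j\<close>, with \<open>A\<close> and
  \<open>i\<close> generalized, because a restart uses the new matrix and the row of a nonzero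
  remainder. Only rows below \<open>p\<close> are swapped or combined with each other, so a column
  that vanishes in all of them keeps doing so; this is how the work on earlier columns
  survives.\<close>

lemma clear_below:
  assumes A: "A \<in> matrices m n M" and j: "j \<in> {1..n}" and i: "i \<in> {p<..m}"
    and nz: "A i j \<noteq> \<zero>\<^bsub>M j\<^esub>"
  shows "\<exists>B. left_row_equivalent R m n M A B \<and> (\<forall>k\<le>p. B k = A k) \<and>
    (\<forall>l\<in>{1..n}. (\<forall>k\<in>{p<..m}. A k l = \<zero>\<^bsub>M l\<^esub>) \<longrightarrow> (\<forall>k\<in>{p<..m}. B k l = \<zero>\<^bsub>M l\<^esub>)) \<and>
    B (Suc p) j \<noteq> \<zero>\<^bsub>M j\<^esub> \<and> (\<forall>k\<in>{Suc p<..m}. B k j = \<zero>\<^bsub>M j\<^esub>)"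
proof -
  interpret E: euclidean_module R "M j" "P j" "leq j" "d j"
    by (rule euclidean[OF j])
  have "A i j \<in> carrier (M j) - {\<zero>\<^bsub>M j\<^esub>}"
    using A i j nz by (auto simp: entry_closed)
  then show ?thesis
    using A i
  proof (induction "A i j" arbitrary: A i rule: E.degree_less_induct)
    case less
    \<comment> \<open>The divisor is moved to row \<open>Suc p\<close>, where the pivot is to end
      up. If it is there already, \<open>S\<close> equals \<open>A\<close>.\<close>
    define S where "S = A(i := A (Suc p), Suc p := A i)"
    have p: "Suc p \<in> {1..m}" and "i \<in> {1..m}"
      using less.prems by auto
    then have AS: "left_row_equivalent R m n M A S"
      unfolding S_def using row_equivalent_swap by blast
    have Sp: "S (Suc p) = A i"
      by (simp add: S_def)
    obtain B where SB: "left_row_equivalent R m n M S B"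
      and fix_rows: "\<And>k. k \<notin> {Suc p<..m} \<Longrightarrow> B k = S k"
      and fix_entries: "\<And>k l. \<lbrakk>k \<in> {Suc p<..m}; l \<in> {1..n}; A i l = \<zero>\<^bsub>M l\<^esub>\<rbrakk> \<Longrightarrow> B k l = S k l"
      and rem: "\<And>k. k \<in> {Suc p<..m} \<Longrightarrow> B k j = \<zero>\<^bsub>M j\<^esub> \<or> deg_less j (B k j) (A i j)"
    proof (rule divide_rows[of S "Suc p" j "{Suc p<..m}"])
      show "S \<in> matrices m n M"
        using row_equivalent_matrices[OF AS less.prems(1)] .
    qed (use j p less.hyps(1) in \<open>auto simp: Sp\<close>)
    have AB: "left_row_equivalent R m n M A B"
      using AS SB by (rule row_equivalent_trans)
    have B: "B \<in> matrices m n M"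
      using row_equivalent_matrices[OF AB less.prems(1)] .
    have top: "\<forall>k\<le>p. B k = A k"
      using fix_rows less.prems(2) by (auto simp: S_def)
    have zeros: "B k l = \<zero>\<^bsub>M l\<^esub>"
      if "l \<in> {1..n}" "\<forall>k\<in>{p<..m}. A k l = \<zero>\<^bsub>M l\<^esub>" "k \<in> {p<..m}" for k l
    proof -
      have "S k l = \<zero>\<^bsub>M l\<^esub>"
        using that less.prems(2) p by (auto simp: S_def)
      then show ?thesis
        using fix_rows[of k] fix_entries[of k l] that less.prems(2) by (cases "k = Suc p") auto
    qed
    have Bp: "B (Suc p) = A i"
      using fix_rows[of "Suc p"] Sp by simp
    show ?case
    proof (cases "\<forall>k\<in>{Suc p<..m}. B k j = \<zero>\<^bsub>M j\<^esub>")
      case True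
      then show ?thesis
        using AB top zeros Bp less.hyps(1) by (intro exI[of _ B]) auto
    next
      case False
      then obtain k where k: "k \<in> {Suc p<..m}" "B k j \<noteq> \<zero>\<^bsub>M j\<^esub>"
        by blast
      \<comment> \<open>A surviving remainder has smaller degree than the divisor, so the induction
        hypothesis applies to \<open>B\<close> and row \<open>k\<close>; its conclusions are then
        composed with those for \<open>B\<close>.\<close>
      then have "B k j \<in> carrier (M j) - {\<zero>\<^bsub>M j\<^esub>}" "deg_less j (B k j) (A i j)"
        using B j rem[of k] by (auto simp: entry_closed)
      from less.hyps(2)[OF this B] k obtain C where
        C: "left_row_equivalent R m n M B C" "\<forall>k\<le>p. C k = B k"
        "\<forall>l\<in>{1..n}. (\<forall>k\<in>{p<..m}. B k l = \<zero>\<^bsub>M l\<^esub>) \<longrightarrow> (\<forall>k\<in>{p<..m}. C k l = \<zero>\<^bsub>M l\<^esub>)"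
        "C (Suc p) j \<noteq> \<zero>\<^bsub>M j\<^esub>" "\<forall>k\<in>{Suc p<..m}. C k j = \<zero>\<^bsub>M j\<^esub>"
        by auto
      show ?thesis
      proof (intro exI[of _ C] conjI)
        show "left_row_equivalent R m n M A C"
          using AB C(1) by (rule row_equivalent_trans)
        show "\<forall>l\<in>{1..n}. (\<forall>k\<in>{p<..m}. A k l = \<zero>\<^bsub>M l\<^esub>) \<longrightarrow> (\<forall>k\<in>{p<..m}. C k l = \<zero>\<^bsub>M l\<^esub>)"
          using C(3) zeros by blast
      qed (use C top in auto)
    qed
  qed
qed

section \<open>Induction over the columns\<close>

text \<open>The first \<open>c\<close> columns are reduced, with pivots at the positions \<open>(i, f i)\<close> for \<open>i \<le> p\<close>.\<close>

definition reduced_upto :: "nat \<Rightarrow> nat \<Rightarrow> (nat \<Rightarrow> nat) \<Rightarrow> (nat \<Rightarrow> nat \<Rightarrow> 'b) \<Rightarrow> bool" where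
  "reduced_upto c p f A \<longleftrightarrow> p \<le> m \<and>
    (\<forall>i\<in>{1..p}. f i \<le> c \<and> is_pivot m n M A i (f i) \<and>
      (\<forall>k\<in>{i<..m}. A k (f i) = \<zero>\<^bsub>M (f i)\<^esub>) \<and>
      (\<forall>k\<in>{1..<i}. A k (f i) = \<zero>\<^bsub>M (f i)\<^esub> \<or> deg_less (f i) (A k (f i)) (A i (f i))) \<and>
      (1 < i \<longrightarrow> f (i - 1) < f i)) \<and>
    (\<forall>i\<in>{p<..m}. \<forall>l\<in>{1..c}. A i l = \<zero>\<^bsub>M l\<^esub>)"

text \<open>If column \<open>Suc c\<close> vanishes below row \<open>p\<close>, then
  \<open>A\<close>, \<open>p\<close> and \<open>f\<close> can be kept. Otherwise
  \<open>clear_below\<close> creates a pivot in row \<open>Suc p\<close>, giving \<open>B\<close>,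
  and the rows above are divided by that row, giving \<open>C\<close>.\<close>

lemma reduced_upto_Suc:
  assumes A: "A \<in> matrices m n M" and red: "reduced_upto c p f A" and c: "c < n"
  shows "\<exists>B p f. left_row_equivalent R m n M A B \<and> reduced_upto (Suc c) p f B"
proof (cases "\<forall>i\<in>{p<..m}. A i (Suc c) = \<zero>\<^bsub>M (Suc c)\<^esub>")
  case True
  have "reduced_upto (Suc c) p f A"
    unfolding reduced_upto_def
  proof (intro conjI)
    show "\<forall>i\<in>{p<..m}. \<forall>l\<in>{1..Suc c}. A i l = \<zero>\<^bsub>M l\<^esub>"
      using red True by (simp add: reduced_upto_def atLeastAtMostSuc_conv)
  qed (use red in \<open>auto simp: reduced_upto_def intro: le_SucI\<close>)
  then show ?thesis
    by (auto simp: left_row_equivalent_def)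
next
  case False
  let ?j = "Suc c"
  have j: "?j \<in> {1..n}"
    using c by simp
  from False obtain i where i: "i \<in> {p<..m}" "A i ?j \<noteq> \<zero>\<^bsub>M ?j\<^esub>"
    by blast
  from clear_below[OF A j i] obtain B where AB: "left_row_equivalent R m n M A B"
    and top: "\<forall>k\<le>p. B k = A k"
    and zeros: "\<forall>l\<in>{1..n}. (\<forall>k\<in>{p<..m}. A k l = \<zero>\<^bsub>M l\<^esub>) \<longrightarrow> (\<forall>k\<in>{p<..m}. B k l = \<zero>\<^bsub>M l\<^esub>)"
    and piv: "B (Suc p) ?j \<noteq> \<zero>\<^bsub>M ?j\<^esub>" and below: "\<forall>k\<in>{Suc p<..m}. B k ?j = \<zero>\<^bsub>M ?j\<^esub>"
    by (elim exE conjE)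
  have p: "Suc p \<in> {1..m}"
    using i by simp
  \<comment> \<open>In particular the new pivot row vanishes in the first \<open>c\<close> columns,
    so that the entry in column \<open>Suc c\<close> is indeed its leftmost nonzero one.\<close>
  have left: "B k l = \<zero>\<^bsub>M l\<^esub>" if "k \<in> {p<..m}" "l \<in> {1..c}" for k l
  proof -
    have "\<forall>k\<in>{p<..m}. A k l = \<zero>\<^bsub>M l\<^esub>"
      using that red by (simp add: reduced_upto_def)
    moreover have "l \<in> {1..n}"
      using that c by simp
    ultimately show ?thesis
      using zeros that by blast
  qed
  obtain C where BC: "left_row_equivalent R m n M B C"
    and fix_rows: "\<And>k. k \<notin> {1..p} \<Longrightarrow> C k = B k"
    and fix_entries: "\<And>k l. \<lbrakk>k \<in> {1..p}; l \<in> {1..n}; B (Suc p) l = \<zero>\<^bsub>M l\<^esub>\<rbrakk> \<Longrightarrow> C k l = B k l"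
    and above: "\<And>k. k \<in> {1..p} \<Longrightarrow> C k ?j = \<zero>\<^bsub>M ?j\<^esub> \<or> deg_less ?j (C k ?j) (B (Suc p) ?j)"
  proof (rule divide_rows[of B "Suc p" ?j "{1..p}"])
    show "B \<in> matrices m n M"
      using row_equivalent_matrices[OF AB A] .
  qed (use j p piv in auto)
  \<comment> \<open>All that is known about the old pivots concerns the first \<open>c\<close>
    columns and carries over by this agreement. In rows up to \<open>p\<close> only multiples of a
    row that is zero there were added; in the rows below, both entries are zero.\<close>
  have CA: "C k l = A k l" if "k \<in> {1..m}" "l \<in> {1..c}" for k l
  proof (cases "k \<le> p")
    case True
    then show ?thesis
      using that fix_entries[of k l] left[of "Suc p" l] top p c by auto
  next
    case False
    then show ?thesis
      using that fix_rows[of k] left[of k l] red by (auto simp: reduced_upto_def)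
  qed
  have C_below: "C k l = \<zero>\<^bsub>M l\<^esub>" if "k \<in> {Suc p<..m}" "l \<in> {1..?j}" for k l
    using that fix_rows[of k] left[of k l] below by (cases "l = ?j") auto
  have "reduced_upto ?j (Suc p) (f(Suc p := ?j)) C"
    unfolding reduced_upto_def
  proof (intro conjI ballI)
    fix i assume i: "i \<in> {1..Suc p}"
    let ?f = "f(Suc p := ?j)"
    let ?thesis = "?f i \<le> ?j \<and> is_pivot m n M C i (?f i) \<and>
      (\<forall>k\<in>{i<..m}. C k (?f i) = \<zero>\<^bsub>M (?f i)\<^esub>) \<and>
      (\<forall>k\<in>{1..<i}. C k (?f i) = \<zero>\<^bsub>M (?f i)\<^esub> \<or> deg_less (?f i) (C k (?f i)) (C i (?f i))) \<and>
      (1 < i \<longrightarrow> ?f (i - 1) < ?f i)"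
    have ?thesis
    proof (cases "i = Suc p")
      case True
      have "is_pivot m n M C i ?j"
        using True p j piv fix_rows[of i] left by (auto simp: is_pivot_def)
      moreover have "\<forall>k\<in>{1..<i}. C k ?j = \<zero>\<^bsub>M ?j\<^esub> \<or> deg_less ?j (C k ?j) (C i ?j)"
        using True above fix_rows[of i] by auto
      \<comment> \<open>The previous pivot is in column \<open>f p\<close>, and the bound
        \<open>f p \<le> c\<close> in the invariant puts it strictly to the left of
        \<open>Suc c\<close>.\<close>
      moreover have "1 < i \<longrightarrow> ?f (i - 1) < ?f i"
        using True red by (auto simp: reduced_upto_def less_Suc_eq_le)
      ultimately show ?thesis
        using True C_below by auto
    next
      case False
      then have i: "i \<in> {1..p}" and f: "?f i = f i" "?f (i - 1) = f (i - 1)"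
        using i by auto
      have piv: "f i \<le> c" "is_pivot m n M A i (f i)"
        using red i by (auto simp: reduced_upto_def)
      then have fi: "f i \<in> {1..c}"
        by (auto simp: is_pivot_def)
      have "is_pivot m n M C i (f i)"
        using piv CA[of i] fi by (auto simp: is_pivot_def)
      moreover have "\<forall>k\<in>{1..m}. C k (f i) = A k (f i)"
        using CA fi by blast
      moreover have "\<forall>k\<in>{i<..m}. A k (f i) = \<zero>\<^bsub>M (f i)\<^esub>"
        "\<forall>k\<in>{1..<i}. A k (f i) = \<zero>\<^bsub>M (f i)\<^esub> \<or> deg_less (f i) (A k (f i)) (A i (f i))"
        "1 < i \<longrightarrow> f (i - 1) < f i"
        using red i by (simp_all add: reduced_upto_def)
      ultimately show ?thesis
        unfolding f using piv(1) i p by auto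
    qed
    then show "?f i \<le> ?j" "is_pivot m n M C i (?f i)"
      "\<And>k. k \<in> {i<..m} \<Longrightarrow> C k (?f i) = \<zero>\<^bsub>M (?f i)\<^esub>"
      "\<And>k. k \<in> {1..<i} \<Longrightarrow> C k (?f i) = \<zero>\<^bsub>M (?f i)\<^esub> \<or> deg_less (?f i) (C k (?f i)) (C i (?f i))"
      "1 < i \<longrightarrow> ?f (i - 1) < ?f i"
      by blast+
  qed (use p C_below in auto)
  then show ?thesis
    using row_equivalent_trans[OF AB BC] by blast
qed

lemma exists_reduced_upto:
  assumes "A \<in> matrices m n M" "c \<le> n"
  shows "\<exists>B p f. left_row_equivalent R m n M A B \<and> reduced_upto c p f B"
  using assms(2)
proof (induction c)
  case 0
  \<comment> \<open>With no columns and no pivots every condition is vacuous, whatever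
    \<open>f\<close> is.\<close>
  have "reduced_upto 0 0 f A" for f
    by (simp add: reduced_upto_def)
  then show ?case
    by (auto simp: left_row_equivalent_def)
next
  case (Suc c)
  then show ?case
    by (meson Suc_leD Suc_le_lessD assms(1) reduced_upto_Suc row_equivalent_matrices
        row_equivalent_trans)
qed

section \<open>From the column invariant to the reduced echelon form\<close>

lemma is_pivot_unique:
  assumes "is_pivot m n M A i j" "is_pivot m n M A i k"
  shows "j = k"
  using assms by (cases j k rule: linorder_cases) (auto simp: is_pivot_def)

lemma nonzero_row_pivot:
  assumes A: "A \<in> matrices m n M" and i: "i \<in> {1..m}" and nz: "A i \<noteq> \<zero>\<^bsub>direct_sum n M\<^esub>"
  shows "\<exists>j. is_pivot m n M A i j"
proof -
  \<comment> \<open>Both the row and the zero of the direct sum are extensional, so they can differ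
    only at an index in \<open>{1..n}\<close>. The least such index with a nonzero entry is the
    pivot column.\<close>
  have "\<exists>j. j \<in> {1..n} \<and> A i j \<noteq> \<zero>\<^bsub>M j\<^esub>"
    using row_closed[OF A i] nz
    by (auto simp: direct_sum_def PiE_def extensional_def fun_eq_iff split: if_splits)
  then have "is_pivot m n M A i (LEAST j. j \<in> {1..n} \<and> A i j \<noteq> \<zero>\<^bsub>M j\<^esub>)"
    unfolding is_pivot_def using i
    by (smt (verit) LeastI_ex atLeastAtMost_iff atLeastLessThan_iff le_trans less_imp_le_nat
        not_less_Least)
  then show ?thesis
    by blast
qed

text \<open>After all \<open>n\<close> columns the rows below \<open>p\<close> are entirely zero and
  have no pivot. Hence the pivots are exactly the positions \<open>(i, f i)\<close> with
  \<open>i\<close> in \<open>{1..p}\<close>, and the invariant speaks about all of them.\<close>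

lemma reduced_upto_imp_echelon:
  assumes A: "A \<in> matrices m n M" and red: "reduced_upto n p f A"
  shows "reduced_echelon_form m n M leq d A"
proof -
  have piv: "i \<in> {1..p} \<and> j = f i" if ij: "is_pivot m n M A i j" for i j
  proof -
    have "i \<in> {1..p}"
      using red ij by (fastforce simp: is_pivot_def reduced_upto_def)
    moreover from this have "is_pivot m n M A i (f i)"
      using red by (simp add: reduced_upto_def)
    ultimately show ?thesis
      using is_pivot_unique[OF ij] by blast
  qed
  show ?thesis
    unfolding reduced_echelon_form_def
  proof (intro conjI allI impI ballI)
    fix i assume "i \<in> {1..m}" "A i \<noteq> \<zero>\<^bsub>direct_sum n M\<^esub>"
    then show "\<exists>j. is_pivot m n M A i j"
      by (rule nonzero_row_pivot[OF A])
  next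
    fix i j k assume ij: "is_pivot m n M A i j" and k: "k \<in> {i<..m}"
    then show "A k j = \<zero>\<^bsub>M j\<^esub>"
      using piv[OF ij] red by (simp add: reduced_upto_def)
  next
    fix i j k assume ij: "is_pivot m n M A i j" and k: "k \<in> {1..<i}"
    have "j \<in> {1..n}"
      using ij by (simp add: is_pivot_def)
    moreover have "A k j = \<zero>\<^bsub>M j\<^esub> \<or> deg_less j (A k j) (A i j)"
      using piv[OF ij] red k by (simp add: reduced_upto_def)
    ultimately show "A k j = \<zero>\<^bsub>M j\<^esub> \<or>
        (d j (A k j), d j (A i j)) \<in> leq j \<and> d j (A k j) \<noteq> d j (A i j)"
      by (simp add: deg_less_iff)
  next
    fix i j assume ij: "is_pivot m n M A i j \<and> 1 < i"
    then have "i \<in> {1..p}" "j = f i" "i - 1 \<in> {1..p}"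
      using piv[of i j] by auto
    then have "f (i - 1) < j" "is_pivot m n M A (i - 1) (f (i - 1))"
      using ij red by (auto simp: reduced_upto_def)
    then show "\<exists>j'<j. is_pivot m n M A (i - 1) j'"
      by blast
  qed
qed

end

theorem theorem4p3:
  fixes R :: "('a, 'r) ring_scheme"
    and M :: "nat \<Rightarrow> ('a, 'b, 'm) module_scheme"
    and P :: "nat \<Rightarrow> 'p set"
    and leq :: "nat \<Rightarrow> 'p rel"
    and d :: "nat \<Rightarrow> 'b \<Rightarrow> 'p"
    and m n :: nat
    and A :: "nat \<Rightarrow> nat \<Rightarrow> 'b"
  assumes "ring R"
    and "\<And>j. j \<in> {1..n} \<Longrightarrow> euclidean_module R (M j) (P j) (leq j) (d j)"
    and "A \<in> matrices m n M"
    and "A \<noteq> zero_matrix m n M"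
  shows "\<exists>B \<in> matrices m n M.
    left_row_equivalent R m n M A B \<and> reduced_echelon_form m n M leq d B"
proof -
  interpret euclidean_modules R M P leq d m n
    using assms(1,2) by (simp add: euclidean_modules_def euclidean_modules_axioms_def)
  obtain B p f where "left_row_equivalent R m n M A B" "reduced_upto n p f B"
    using exists_reduced_upto[OF assms(3), of n] by blast
  then show ?thesis
    using row_equivalent_matrices[OF _ assms(3)] reduced_upto_imp_echelon by blast
qed

end
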